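(* Let $\{\alpha_n\}_{n\in\mathbb{N}}$ be a sequence in $\mathrm{M}^+(\Omega)$ such that $\alpha_n\to\alpha$ strongly in $\mathrm{M}(\Omega)$ for some $\alpha$, and let $\mu\in\mathbf{K}(\alpha)$ be arbitrary. Then there exists a sequence $\{\mu_n\}$ in $\mathrm{M}(\Omega)^N$ such that $\mu_n\in\mathbf{K}(\alpha_n)$ for all $n\in\mathbb{N}$ and $\mu_n\to\mu$ strongly in $\mathrm{M}(\Omega)^N$.
   Context: $\Omega$ is an open subset of $\mathbb{R}^M$, $M,N\in\mathbb{N}$. $\mathrm{M}(\Omega)$ and $\mathrm{M}(\Omega)^N$ are the spaces of (finite) real-valued, respectively $\mathbb{R}^N$-valued, measures on the Borel $\sigma$-algebra $\mathcal{B}(\Omega)$, and $\mathrm{M}^+(\Omega)\subset\mathrm{M}(\Omega)$ is the set of non-negative ones. $|\mu|\in\mathrm{M}^+(\Omega)$ is the total variation measure of $\mu\in\mathrm{M}(\Omega)^N$ (with respect to the Euclidean norm), and $\|\mu\|_{\mathrm{M}(\Omega)^N}=|\mu|(\Omega)$; strong convergence is convergence in this norm. For $\mu,\sigma\in\mathrm{M}(\Omega)$, $\mu\le\sigma$ means $\sigma-\mu\in\mathrm{M}^+(\Omega)$. For $\alpha\in\mathrm{M}^+(\Omega)$, $\mathbf{K}(\alpha)=\{\mu\in\mathrm{M}(\Omega)^N:|\mu|\le\alpha\}$. *)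

theory Defs
  imports "HOL-Analysis.Analysis"
begin

text \<open>
  Signed and vector-valued measures are rendered as \<open>\<sigma>\<close>-additive set functions. The argument \<open>M\<close>
  only supplies the measurable space; the measure it carries is never used. Set functions are
  required to vanish on non-measurable sets, so that equality of measures is equality in HOL
  and sums and differences of measures are the pointwise ones.
\<close>

definition vector_measures :: "'a measure \<Rightarrow> ('a set \<Rightarrow> 'b::real_normed_vector) set" where
  "vector_measures M =
     {\<mu>. (\<forall>A. range A \<subseteq> sets M \<longrightarrow> disjoint_family A \<longrightarrow> (\<lambda>i. \<mu> (A i)) sums \<mu> (\<Union>i::nat. A i)) \<and>
         (\<forall>A. A \<notin> sets M \<longrightarrow> \<mu> A = 0)}"

definition pos_measures :: "'a measure \<Rightarrow> ('a set \<Rightarrow> real) set" where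
  "pos_measures M = {\<mu> \<in> vector_measures M. \<forall>A\<in>sets M. 0 \<le> \<mu> A}"

definition measurable_partitions :: "'a measure \<Rightarrow> 'a set \<Rightarrow> (nat \<Rightarrow> 'a set) set" where
  "measurable_partitions M A = {E. range E \<subseteq> sets M \<and> disjoint_family E \<and> (\<Union>i. E i) = A}"

definition variation :: "'a measure \<Rightarrow> ('a set \<Rightarrow> 'b::real_normed_vector) \<Rightarrow> 'a set \<Rightarrow> ennreal" where
  "variation M \<mu> A = (SUP E\<in>measurable_partitions M A. \<Sum>i. ennreal (norm (\<mu> (E i))))"

text \<open>
  The conversion to the reals loses nothing for measures with values in a Euclidean space:
  see \<open>variation_finite\<close> and \<open>total_variation_pos_measures\<close> below. On a non-measurable set there
  is no partition and the value is \<open>0\<close>.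
\<close>

definition total_variation :: "'a measure \<Rightarrow> ('a set \<Rightarrow> 'b::real_normed_vector) \<Rightarrow> 'a set \<Rightarrow> real" where
  "total_variation M \<mu> A = enn2real (variation M \<mu> A)"

definition tv_norm :: "'a measure \<Rightarrow> ('a set \<Rightarrow> 'b::real_normed_vector) \<Rightarrow> real" where
  "tv_norm M \<mu> = total_variation M \<mu> (space M)"

definition tv_tendsto ::
    "'a measure \<Rightarrow> (nat \<Rightarrow> 'a set \<Rightarrow> 'b::real_normed_vector) \<Rightarrow> ('a set \<Rightarrow> 'b) \<Rightarrow> bool" where
  "tv_tendsto M \<mu> \<nu> \<longleftrightarrow> (\<lambda>n. tv_norm M (\<mu> n - \<nu>)) \<longlonglongrightarrow> 0"

definition measure_le :: "'a measure \<Rightarrow> ('a set \<Rightarrow> real) \<Rightarrow> ('a set \<Rightarrow> real) \<Rightarrow> bool" where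
  "measure_le M \<mu> \<sigma> \<longleftrightarrow> \<sigma> - \<mu> \<in> pos_measures M"

definition K_set :: "'a measure \<Rightarrow> ('a set \<Rightarrow> real) \<Rightarrow> ('a set \<Rightarrow> 'b::real_normed_vector) set" where
  "K_set M \<alpha> = {\<mu> \<in> vector_measures M. measure_le M (total_variation M \<mu>) \<alpha>}"

abbreviation borel_on :: "'a::topological_space set \<Rightarrow> 'a measure" where
  "borel_on \<Omega> \<equiv> restrict_space borel \<Omega>"

lemma vector_measures_sums:
  assumes "\<mu> \<in> vector_measures M" "range A \<subseteq> sets M" "disjoint_family A"
  shows "(\<lambda>i. \<mu> (A i)) sums \<mu> (\<Union>i::nat. A i)"
  using assms unfolding vector_measures_def by blast

lemma vector_measures_empty:
  assumes "\<mu> \<in> vector_measures M"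
  shows "\<mu> {} = 0"
proof -
  have "(\<lambda>i::nat. \<mu> {}) sums \<mu> {}"
    using vector_measures_sums[OF assms, of "\<lambda>_. {}"] by (simp add: disjoint_family_on_def)
  then have "(\<lambda>i::nat. \<mu> {}) \<longlonglongrightarrow> 0"
    using sums_summable summable_LIMSEQ_zero by blast
  then show ?thesis by (simp add: LIMSEQ_const_iff)
qed

lemma vector_measures_finite_sum:
  fixes I :: "nat set"
  assumes mu: "\<mu> \<in> vector_measures M"
    and B: "finite I" "\<And>i. i \<in> I \<Longrightarrow> B i \<in> sets M" "disjoint_family_on B I"
  shows "\<mu> (\<Union>i\<in>I. B i) = (\<Sum>i\<in>I. \<mu> (B i))"
proof -
  define E where "E i = (if i \<in> I then B i else {})" for i
  have "(\<lambda>i. \<mu> (E i)) sums \<mu> (\<Union>i. E i)"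
    using B by (intro vector_measures_sums[OF mu])
      (auto simp: E_def disjoint_family_on_def split: if_splits)
  moreover have "(\<Union>i. E i) = (\<Union>i\<in>I. B i)"
    by (auto simp: E_def split: if_splits)
  moreover have "(\<lambda>i. \<mu> (E i)) sums (\<Sum>i\<in>I. \<mu> (E i))"
    using B(1) vector_measures_empty[OF mu] by (intro sums_finite) (auto simp: E_def)
  moreover have "(\<Sum>i\<in>I. \<mu> (E i)) = (\<Sum>i\<in>I. \<mu> (B i))"
    by (intro sum.cong) (auto simp: E_def)
  ultimately show ?thesis using sums_unique2 by fastforce
qed

lemma vector_measures_Un:
  assumes mu: "\<mu> \<in> vector_measures M" and "A \<in> sets M" "B \<in> sets M" "A \<inter> B = {}"
  shows "\<mu> (A \<union> B) = \<mu> A + \<mu> B"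
proof -
  have "\<mu> (\<Union>i\<in>{0,1::nat}. if i = 0 then A else B) =
      (\<Sum>i\<in>{0,1::nat}. \<mu> (if i = 0 then A else B))"
    using assms by (intro vector_measures_finite_sum[OF mu])
      (auto simp: disjoint_family_on_def)
  then show ?thesis by (simp add: Un_commute)
qed

lemma vector_measures_bounded:
  assumes mu: "\<mu> \<in> vector_measures M"
  shows "\<exists>C. \<forall>B\<in>sets M. norm (\<mu> B) \<le> C"
proof (rule ccontr)
  define unb where
    "unb A \<longleftrightarrow> A \<in> sets M \<and> (\<forall>C. \<exists>B\<in>sets M. B \<subseteq> A \<and> norm (\<mu> B) > C)" for A
  assume "\<not> ?thesis"
  then have unb0: "unb (space M)"
    unfolding unb_def by (meson not_le sets.sets_into_space sets.top)
  have unbI: "unb B \<or> unb D" if A: "unb A" "A = B \<union> D" "B \<inter> D = {}" "B \<in> sets M" "D \<in> sets M" for A B D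
  proof (rule ccontr)
    assume "\<not> ?thesis"
    then obtain c d where c: "\<And>E. E \<in> sets M \<Longrightarrow> E \<subseteq> B \<Longrightarrow> norm (\<mu> E) \<le> c"
      and d: "\<And>E. E \<in> sets M \<Longrightarrow> E \<subseteq> D \<Longrightarrow> norm (\<mu> E) \<le> d"
      using A unfolding unb_def by (meson not_le)
    obtain E where E: "E \<in> sets M" "E \<subseteq> A" "norm (\<mu> E) > c + d"
      using A(1) unfolding unb_def by blast
    have "\<mu> E = \<mu> (E \<inter> B) + \<mu> (E \<inter> D)"
      using vector_measures_Un[OF mu, of "E \<inter> B" "E \<inter> D"] A E
      by (simp add: Int_Un_distrib[symmetric] Int_absorb2) blast
    then have "norm (\<mu> E) \<le> c + d"
      using norm_triangle_ineq[of "\<mu> (E \<inter> B)" "\<mu> (E \<inter> D)"] c[of "E \<inter> B"] d[of "E \<inter> D"] E A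
      by simp
    then show False using E by simp
  qed
  have step: "\<exists>A'. unb A' \<and> (A' \<subseteq> A \<and> 1 \<le> norm (\<mu> (A - A')))" if A: "unb A" for A
  proof -
    obtain B where B: "B \<in> sets M" "B \<subseteq> A" "norm (\<mu> B) > norm (\<mu> A) + 1"
      using A unfolding unb_def by blast
    have AM: "A \<in> sets M" using A unfolding unb_def by simp
    have "\<mu> A = \<mu> B + \<mu> (A - B)"
      using vector_measures_Un[OF mu, of B "A - B"] B AM by (simp add: Un_absorb1)
    then have "\<mu> (A - B) = \<mu> A - \<mu> B" by simp
    then have n1: "1 \<le> norm (\<mu> (A - B))"
      using B(3) norm_triangle_ineq2[of "\<mu> B" "\<mu> A"] by (simp add: norm_minus_commute)
    have n2: "1 \<le> norm (\<mu> (A - (A - B)))"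
    proof -
      have "A - (A - B) = B" using B(2) by blast
      then show ?thesis using B(3) norm_ge_zero[of "\<mu> A"] by (simp only:)
    qed
    have "unb B \<or> unb (A - B)"
      using A B AM by (intro unbI[of A]) auto
    then show ?thesis using n1 n2 B by blast
  qed
  obtain F where F: "\<And>n. unb (F n)" "\<And>n. F (Suc n) \<subseteq> F n \<and> 1 \<le> norm (\<mu> (F n - F (Suc n)))"
    using dependent_nat_choice[of "\<lambda>_. unb" "\<lambda>_ A A'. A' \<subseteq> A \<and> 1 \<le> norm (\<mu> (A - A'))"] unb0 step
    by metis
  have dec: "decseq F" using F(2) by (simp add: decseq_Suc_iff)
  define G where "G n = F n - F (Suc n)" for n
  have "disjoint_family G"
  proof -
    have "G i \<inter> G j = {}" if "i < j" for i j
      using decseqD[OF dec, of "Suc i" j] that unfolding G_def by auto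
    then show ?thesis
      unfolding disjoint_family_on_def by (metis inf_commute nat_neq_iff)
  qed
  moreover have "range G \<subseteq> sets M"
    using F(1) unfolding G_def unb_def by auto
  ultimately have "(\<lambda>i. \<mu> (G i)) \<longlonglongrightarrow> 0"
    using vector_measures_sums[OF mu] sums_summable summable_LIMSEQ_zero by blast
  then have "eventually (\<lambda>i. norm (\<mu> (G i)) < 1) sequentially"
    using tendsto_norm_zero order_tendstoD(2) zero_less_one by metis
  then obtain i where "norm (\<mu> (G i)) < 1"
    using eventually_happens trivial_limit_sequentially by blast
  moreover have "1 \<le> norm (\<mu> (G i))"
    using F(2) unfolding G_def by blast
  ultimately show False by simp
qed

lemma variation_finite:
  fixes \<mu> :: "'a set \<Rightarrow> 'b::euclidean_space"
  assumes mu: "\<mu> \<in> vector_measures M"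
  shows "variation M \<mu> A < \<infinity>"
proof -
  obtain C where C: "\<And>B. B \<in> sets M \<Longrightarrow> norm (\<mu> B) \<le> C"
    using vector_measures_bounded[OF mu] by blast
  have fin: "(\<Sum>i<n. norm (\<mu> (E i))) \<le> DIM('b) * (2 * C)"
    if E: "range E \<subseteq> sets M" "disjoint_family E" for E :: "nat \<Rightarrow> 'a set" and n
  proof -
    have comp: "(\<Sum>i<n. \<bar>\<mu> (E i) \<bullet> b\<bar>) \<le> 2 * C" if b: "b \<in> Basis" for b
    proof -
      have *: "\<bar>\<Sum>i\<in>I. \<mu> (E i) \<bullet> b\<bar> \<le> C" if I: "I \<subseteq> {..<n}" for I
      proof -
        have "finite I" using I finite_subset by blast
        have D: "disjoint_family_on E I"
          using E(2) unfolding disjoint_family_on_def by auto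
        have "(\<Sum>i\<in>I. \<mu> (E i) \<bullet> b) = \<mu> (\<Union>i\<in>I. E i) \<bullet> b"
          using vector_measures_finite_sum[OF mu \<open>finite I\<close> _ D] E
          by (auto simp: inner_sum_left)
        moreover have "(\<Union>i\<in>I. E i) \<in> sets M"
          using E \<open>finite I\<close> by auto
        ultimately show ?thesis
          using Basis_le_norm[OF b] C by (metis order_trans)
      qed
      let ?P = "{i\<in>{..<n}. \<mu> (E i) \<bullet> b \<ge> 0}" and ?N = "{i\<in>{..<n}. \<not> \<mu> (E i) \<bullet> b \<ge> 0}"
      have "(\<Sum>i<n. \<bar>\<mu> (E i) \<bullet> b\<bar>) = (\<Sum>i\<in>?P. \<bar>\<mu> (E i) \<bullet> b\<bar>) + (\<Sum>i\<in>?N. \<bar>\<mu> (E i) \<bullet> b\<bar>)"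
        by (subst sum.union_disjoint[symmetric]) (auto intro: sum.cong)
      also have "\<dots> = (\<Sum>i\<in>?P. \<mu> (E i) \<bullet> b) + - (\<Sum>i\<in>?N. \<mu> (E i) \<bullet> b)"
        unfolding sum_negf[symmetric] by (intro arg_cong2[of _ _ _ _ "(+)"] sum.cong) auto
      also have "\<dots> \<le> C + C"
        using *[of ?P] *[of ?N] by (intro add_mono) (auto simp: abs_le_iff)
      finally show ?thesis by simp
    qed
    have "(\<Sum>i<n. norm (\<mu> (E i))) \<le> (\<Sum>i<n. \<Sum>b\<in>Basis. \<bar>\<mu> (E i) \<bullet> b\<bar>)"
      by (intro sum_mono norm_le_l1)
    also have "\<dots> = (\<Sum>b\<in>Basis. \<Sum>i<n. \<bar>\<mu> (E i) \<bullet> b\<bar>)" by (rule sum.swap)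
    also have "\<dots> \<le> (\<Sum>b\<in>(Basis :: 'b set). 2 * C)" by (intro sum_mono comp)
    finally show ?thesis by simp
  qed
  have "variation M \<mu> A \<le> ennreal (DIM('b) * (2 * C))"
    unfolding variation_def
  proof (rule SUP_least)
    fix E assume "E \<in> measurable_partitions M A"
    then have "range E \<subseteq> sets M" "disjoint_family E" by (auto simp: measurable_partitions_def)
    then show "(\<Sum>i. ennreal (norm (\<mu> (E i)))) \<le> ennreal (DIM('b) * (2 * C))"
      using fin by (intro suminf_le_const) (auto simp: sum_ennreal intro!: ennreal_leI)
  qed
  then show ?thesis by (simp add: le_less_trans)
qed

lemma variation_ge_suminf:
  assumes "range E \<subseteq> sets M" "disjoint_family E"
  shows "(\<Sum>i. ennreal (norm (\<mu> (E i)))) \<le> variation M \<mu> (\<Union>i. E i)"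
  unfolding variation_def using assms
  by (intro SUP_upper2[of E]) (auto simp: measurable_partitions_def)

lemma measurable_partitions_nonempty:
  assumes "A \<in> sets M"
  shows "measurable_partitions M A \<noteq> {}"
proof -
  have "(\<lambda>i::nat. if i = 0 then A else {}) \<in> measurable_partitions M A"
    using assms unfolding measurable_partitions_def disjoint_family_on_def
    by (auto split: if_splits)
  then show ?thesis by blast
qed

lemma variation_superadd:
  assumes AB: "A \<in> sets M" "B \<in> sets M" "A \<inter> B = {}"
  shows "variation M \<mu> A + variation M \<mu> B \<le> variation M \<mu> (A \<union> B)"
proof -
  have merge: "(\<Sum>i. ennreal (norm (\<mu> (E i)))) + (\<Sum>i. ennreal (norm (\<mu> (F i)))) \<le> variation M \<mu> (A \<union> B)"
    if E: "E \<in> measurable_partitions M A" and F: "F \<in> measurable_partitions M B" for E F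
  proof -
    define G where "G n = (if even n then E (n div 2) else F (n div 2))" for n :: nat
    let ?f = "\<lambda>E i. ennreal (norm (\<mu> (E i)))"
    have G: "(\<Union>i. G i) = A \<union> B"
    proof -
      have "E i = G (2 * i)" "F i = G (2 * i + 1)" for i by (auto simp: G_def)
      then have "(\<Union>i. E i) \<subseteq> (\<Union>i. G i)" "(\<Union>i. F i) \<subseteq> (\<Union>i. G i)" by blast+
      moreover have "(\<Union>i. G i) \<subseteq> (\<Union>i. E i) \<union> (\<Union>i. F i)" by (auto simp: G_def split: if_splits)
      moreover have "(\<Union>i. E i) = A" "(\<Union>i. F i) = B"
        using E F by (auto simp: measurable_partitions_def)
      ultimately show ?thesis by (simp only:) (rule equalityI, simp_all)
    qed
    have Gd: "disjoint_family G"
    proof -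
      have EF: "E i \<inter> F j = {}" for i j
        using E F AB(3) unfolding measurable_partitions_def by blast
      have "G i \<inter> G j = {}" if "i \<noteq> j" for i j
      proof (cases "even i = even j")
        case True
        then have "i div 2 \<noteq> j div 2" using that
          by (metis even_two_times_div_two odd_two_times_div_two_succ)
        then show ?thesis using True E F
          unfolding G_def measurable_partitions_def disjoint_family_on_def by simp
      next
        case False
        then show ?thesis using EF unfolding G_def by (auto simp: Int_commute)
      qed
      then show ?thesis unfolding disjoint_family_on_def by blast
    qed
    have Gr: "range G \<subseteq> sets M"
      using E F unfolding G_def measurable_partitions_def by auto
    have part: "(\<Sum>k<n. ?f E k + ?f F k) = (\<Sum>k<2*n. ?f G k)" for n
      by (induction n) (auto simp: G_def add.assoc)
    have "(\<Sum>i. ?f E i) + (\<Sum>i. ?f F i) = (\<Sum>i. ?f E i + ?f F i)"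
      by (intro suminf_add) auto
    also have "\<dots> \<le> (\<Sum>i. ?f G i)"
      by (intro suminf_le_const) (auto simp: part simp del: sum_ennreal intro!: sum_le_suminf)
    also have "\<dots> \<le> variation M \<mu> (A \<union> B)"
      using variation_ge_suminf[OF Gr Gd] G by simp
    finally show ?thesis .
  qed
  show ?thesis
    unfolding variation_def[of M \<mu> A] variation_def[of M \<mu> B]
    using merge measurable_partitions_nonempty[OF AB(1)] measurable_partitions_nonempty[OF AB(2)]
    by (simp add: ennreal_SUP_add_left[symmetric] ennreal_SUP_add_right SUP_le_iff)
qed

lemma variation_mono:
  assumes "A \<in> sets M" "B \<in> sets M" "A \<subseteq> B"
  shows "variation M \<mu> A \<le> variation M \<mu> B"
proof -
  have "variation M \<mu> A \<le> variation M \<mu> A + variation M \<mu> (B - A)" by simp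
  also have "\<dots> \<le> variation M \<mu> (A \<union> (B - A))"
    using assms by (intro variation_superadd) auto
  also have "A \<union> (B - A) = B" using assms by blast
  finally show ?thesis .
qed

lemma variation_countably_additive:
  fixes \<mu> :: "'a set \<Rightarrow> 'b::euclidean_space"
  assumes mu: "\<mu> \<in> vector_measures M" and A: "range A \<subseteq> sets M" "disjoint_family A"
  shows "(\<Sum>i. variation M \<mu> (A i)) = variation M \<mu> (\<Union>i::nat. A i)"
proof (rule antisym)
  have UM: "(\<Union>i\<in>I. A i) \<in> sets M" for I
    using A(1) by (intro sets.countable_UN') auto
  have fin: "(\<Sum>i<n. variation M \<mu> (A i)) \<le> variation M \<mu> (\<Union>i<n. A i)" for n
  proof (induction n)
    case (Suc n)
    have "(\<Sum>i<Suc n. variation M \<mu> (A i)) \<le> variation M \<mu> (\<Union>i<n. A i) + variation M \<mu> (A n)"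
      using Suc by (simp add: add_right_mono)
    also have "\<dots> \<le> variation M \<mu> ((\<Union>i<n. A i) \<union> A n)"
    proof (intro variation_superadd)
      have "A i \<inter> A n = {}" if "i < n" for i
        using A(2) that unfolding disjoint_family_on_def by simp
      then show "(\<Union>i<n. A i) \<inter> A n = {}" by blast
    qed (use A(1) UM in auto)
    also have "(\<Union>i<n. A i) \<union> A n = (\<Union>i<Suc n. A i)" by (auto simp: lessThan_Suc)
    finally show ?case .
  qed simp
  show "(\<Sum>i. variation M \<mu> (A i)) \<le> variation M \<mu> (\<Union>i. A i)"
  proof (intro suminf_le_const)
    fix n
    have "variation M \<mu> (\<Union>i<n. A i) \<le> variation M \<mu> (\<Union>i. A i)"
      using UM by (intro variation_mono) auto
    then show "(\<Sum>i<n. variation M \<mu> (A i)) \<le> variation M \<mu> (\<Union>i. A i)"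
      using fin[of n] by simp
  qed simp
next
  show "variation M \<mu> (\<Union>i. A i) \<le> (\<Sum>i. variation M \<mu> (A i))"
    unfolding variation_def[of M \<mu> "\<Union>i. A i"]
  proof (rule SUP_least)
    fix E assume E: "E \<in> measurable_partitions M (\<Union>i. A i)"
    then have Es: "range E \<subseteq> sets M" "disjoint_family E" "(\<Union>i. E i) = (\<Union>i. A i)"
      by (auto simp: measurable_partitions_def)
    have 1: "ennreal (norm (\<mu> (E j))) \<le> (\<Sum>i. ennreal (norm (\<mu> (E j \<inter> A i))))" for j
    proof (cases "(\<Sum>i. ennreal (norm (\<mu> (E j \<inter> A i)))) = top")
      case False
      have "(\<lambda>i. \<mu> (E j \<inter> A i)) sums \<mu> (\<Union>i. E j \<inter> A i)"
        using A Es by (intro vector_measures_sums[OF mu]) (auto simp: disjoint_family_on_def)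
      moreover have "(\<Union>i. E j \<inter> A i) = E j"
        using Es(3) by blast
      ultimately have s: "\<mu> (E j) = (\<Sum>i. \<mu> (E j \<inter> A i))"
        by (simp add: sums_unique)
      have sm: "summable (\<lambda>i. norm (\<mu> (E j \<inter> A i)))"
        using False by (intro summable_suminf_not_top) auto
      show ?thesis
        unfolding s using summable_norm[OF sm] sm
        by (subst suminf_ennreal2) (auto intro!: ennreal_leI)
    qed simp
    have "(\<Sum>j. ennreal (norm (\<mu> (E j)))) \<le> (\<Sum>j. \<Sum>i. ennreal (norm (\<mu> (E j \<inter> A i))))"
      by (intro suminf_le 1) auto
    also have "\<dots> = (\<Sum>i. \<Sum>j. ennreal (norm (\<mu> (E j \<inter> A i))))"
      using nn_integral_suminf[of "\<lambda>i j. ennreal (norm (\<mu> (E j \<inter> A i)))" "count_space UNIV"]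
      unfolding nn_integral_count_space_nat by (metis borel_measurable_count_space)
    also have "\<dots> \<le> (\<Sum>i. variation M \<mu> (A i))"
    proof (intro suminf_le)
      fix i
      have U: "(\<Union>j. E j \<inter> A i) = A i" using Es(3) by blast
      have "range (\<lambda>j. E j \<inter> A i) \<subseteq> sets M" using A(1) Es(1) by auto
      moreover have "disjoint_family (\<lambda>j. E j \<inter> A i)"
        using Es(2) unfolding disjoint_family_on_def by blast
      ultimately show "(\<Sum>j. ennreal (norm (\<mu> (E j \<inter> A i)))) \<le> variation M \<mu> (A i)"
        using variation_ge_suminf[of "\<lambda>j. E j \<inter> A i" M \<mu>] unfolding U by blast
    qed auto
    finally show "(\<Sum>j. ennreal (norm (\<mu> (E j)))) \<le> (\<Sum>i. variation M \<mu> (A i))" .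
  qed
qed

lemma total_variation_pos_measures:
  fixes \<mu> :: "'a set \<Rightarrow> 'b::euclidean_space"
  assumes mu: "\<mu> \<in> vector_measures M"
  shows "total_variation M \<mu> \<in> pos_measures M"
proof -
  have en: "ennreal (total_variation M \<mu> A) = variation M \<mu> A" for A
    using variation_finite[OF mu, of A] by (simp add: total_variation_def)
  have nn: "0 \<le> total_variation M \<mu> A" for A by (simp add: total_variation_def)
  have "(\<lambda>i. total_variation M \<mu> (A i)) sums total_variation M \<mu> (\<Union>i::nat. A i)"
    if A: "range A \<subseteq> sets M" "disjoint_family A" for A
  proof -
    have "(\<lambda>i. variation M \<mu> (A i)) sums variation M \<mu> (\<Union>i. A i)"
      using variation_countably_additive[OF mu A] by (simp add: sums_iff)
    then show ?thesis
      unfolding en[symmetric] using nn by simp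
  qed
  moreover have "total_variation M \<mu> A = 0" if "A \<notin> sets M" for A
  proof -
    have "measurable_partitions M A = {}"
      using that by (auto simp: measurable_partitions_def)
    then show ?thesis by (simp add: total_variation_def variation_def bot_ennreal)
  qed
  ultimately show ?thesis
    using nn unfolding pos_measures_def vector_measures_def by auto
qed

end

theory Submission
  imports Defs "HOL-Library.Function_Algebras"
begin

text \<open>
  By Radon--Nikodym \<open>\<mu> = h \<alpha>\<close> with a density of norm at most \<open>1\<close>, and \<open>\<mu>\<^sub>n = h \<alpha>\<^sub>n\<close> works:
  \<open>|\<mu>\<^sub>n| \<le> \<alpha>\<^sub>n\<close> is clear and \<open>\<mu>\<^sub>n - \<mu> = h (\<alpha>\<^sub>n - \<alpha>)\<close> is dominated by a multiple of \<open>|\<alpha>\<^sub>n - \<alpha>|\<close>.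
\<close>

section \<open>Set functions and their variation\<close>

lemma vector_measures_add:
  assumes "\<mu> \<in> vector_measures M" "\<nu> \<in> vector_measures M"
  shows "\<mu> + \<nu> \<in> vector_measures M"
  using assms unfolding vector_measures_def by (auto intro: sums_add)

lemma vector_measures_diff:
  assumes "\<mu> \<in> vector_measures M" "\<nu> \<in> vector_measures M"
  shows "\<mu> - \<nu> \<in> vector_measures M"
  using assms unfolding vector_measures_def by (auto intro: sums_diff)

lemma vector_measures_inner:
  assumes "\<mu> \<in> vector_measures M"
  shows "(\<lambda>A. \<mu> A \<bullet> b) \<in> vector_measures M"
  using assms unfolding vector_measures_def
  by (auto intro: bounded_linear.sums[OF bounded_linear_inner_left])

lemma pos_measures_add:
  assumes "\<mu> \<in> pos_measures M" "\<nu> \<in> pos_measures M"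
  shows "\<mu> + \<nu> \<in> pos_measures M"
  using assms unfolding pos_measures_def by (auto intro: vector_measures_add)

text \<open>The set \<open>A\<close>, padded with empty sets, is one of the partitions over which
  the supremum in \<open>variation\<close> is taken.\<close>

lemma norm_le_total_variation:
  fixes \<mu> :: "'a set \<Rightarrow> 'b::euclidean_space"
  assumes mu: "\<mu> \<in> vector_measures M" and A: "A \<in> sets M"
  shows "norm (\<mu> A) \<le> total_variation M \<mu> A"
proof -
  let ?E = "\<lambda>i::nat. if i = 0 then A else {}"
  have U: "(\<Union>i. ?E i) = A" by (auto split: if_splits)
  have "ennreal (norm (\<mu> A)) = (\<Sum>i\<in>{0}. ennreal (norm (\<mu> (?E i))))"
    by simp
  also have "\<dots> \<le> (\<Sum>i. ennreal (norm (\<mu> (?E i))))"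
    by (intro sum_le_suminf) auto
  also have "\<dots> \<le> variation M \<mu> (\<Union>i. ?E i)"
    using A by (intro variation_ge_suminf) (auto simp: disjoint_family_on_def)
  finally have "ennreal (norm (\<mu> A)) \<le> variation M \<mu> A"
    unfolding U .
  \<comment> \<open>Finiteness has to be known before passing to the reals: \<open>enn2real\<close>
    sends \<open>top\<close> to 0 and is monotone only below \<open>top\<close>.\<close>
  moreover have "variation M \<mu> A < top"
    using variation_finite[OF mu] by simp
  ultimately show ?thesis
    unfolding total_variation_def by (metis enn2real_ennreal enn2real_mono norm_ge_zero)
qed

text \<open>For any partition of \<open>A\<close>, the terms are dominated by
  \<open>\<beta> (E i)\<close>, and these add up to \<open>\<beta> A\<close>. With
  \<open>norm_le_total_variation\<close> this makes the total variation the least positive measure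
  dominating the norm.\<close>

lemma total_variation_le:
  assumes nu: "\<beta> \<in> pos_measures M"
    and le: "\<And>A. A \<in> sets M \<Longrightarrow> norm (\<mu> A) \<le> \<beta> A"
    and A: "A \<in> sets M"
  shows "total_variation M \<mu> A \<le> \<beta> A"
proof -
  have pos: "\<And>B. B \<in> sets M \<Longrightarrow> 0 \<le> \<beta> B" and vm: "\<beta> \<in> vector_measures M"
    using nu by (auto simp: pos_measures_def)
  have "variation M \<mu> A \<le> ennreal (\<beta> A)"
    unfolding variation_def
  proof (rule SUP_least)
    fix E assume "E \<in> measurable_partitions M A"
    then have E: "range E \<subseteq> sets M" "disjoint_family E" "(\<Union>i. E i) = A"
      by (auto simp: measurable_partitions_def)
    have s: "(\<lambda>i. \<beta> (E i)) sums \<beta> A"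
      using vector_measures_sums[OF vm E(1,2)] E(3) by simp
    have "(\<Sum>i. ennreal (norm (\<mu> (E i)))) \<le> (\<Sum>i. ennreal (\<beta> (E i)))"
      using E(1) le by (intro suminf_le ennreal_leI) auto
    also have "\<dots> = ennreal (\<beta> A)"
      using E(1) pos s by (subst suminf_ennreal2) (auto simp: sums_iff)
    finally show "(\<Sum>i. ennreal (norm (\<mu> (E i)))) \<le> ennreal (\<beta> A)" .
  qed
  then show ?thesis
    unfolding total_variation_def using pos[OF A] by (simp add: enn2real_leI)
qed

text \<open>Replaces the inequality between measures by a setwise bound on \<open>\<mu>\<close>
  itself, which can be checked without partitions. Both directions rest on the minimality of the
  total variation.\<close>

lemma K_set_iff:
  fixes \<mu> :: "'a set \<Rightarrow> 'b::euclidean_space"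
  assumes "\<alpha> \<in> pos_measures M"
  shows "\<mu> \<in> K_set M \<alpha> \<longleftrightarrow> \<mu> \<in> vector_measures M \<and> (\<forall>A\<in>sets M. norm (\<mu> A) \<le> \<alpha> A)"
proof (intro iffI conjI ballI)
  assume K: "\<mu> \<in> K_set M \<alpha>"
  then show vm: "\<mu> \<in> vector_measures M" by (simp add: K_set_def)
  fix A assume A: "A \<in> sets M"
  have "0 \<le> (\<alpha> - total_variation M \<mu>) A"
    using K A unfolding K_set_def measure_le_def pos_measures_def by blast
  then show "norm (\<mu> A) \<le> \<alpha> A"
    using norm_le_total_variation[OF vm A] by simp
next
  assume R: "\<mu> \<in> vector_measures M \<and> (\<forall>A\<in>sets M. norm (\<mu> A) \<le> \<alpha> A)"
  then have "total_variation M \<mu> \<in> vector_measures M"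
    using total_variation_pos_measures[of \<mu> M] by (simp add: pos_measures_def)
  then have "\<alpha> - total_variation M \<mu> \<in> vector_measures M"
    using assms by (intro vector_measures_diff) (auto simp: pos_measures_def)
  then show "\<mu> \<in> K_set M \<alpha>"
    using R total_variation_le[OF assms, of \<mu>]
    by (simp add: K_set_def measure_le_def pos_measures_def)
qed

text \<open>The strong limit \<alpha> is only given as a signed measure; its positivity is read off
  from \<alpha> = |\<mu>| + (\<alpha> - |\<mu>|), a sum of two positive measures.\<close>

lemma K_set_nonempty_imp_pos:
  fixes \<mu> :: "'a set \<Rightarrow> 'b::euclidean_space"
  assumes "\<mu> \<in> K_set M \<alpha>"
  shows "\<alpha> \<in> pos_measures M"
proof -
  have "total_variation M \<mu> \<in> pos_measures M" "\<alpha> - total_variation M \<mu> \<in> pos_measures M"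
    using assms total_variation_pos_measures[of \<mu> M]
    by (auto simp: K_set_def measure_le_def)
  then have "total_variation M \<mu> + (\<alpha> - total_variation M \<mu>) \<in> pos_measures M"
    by (rule pos_measures_add)
  then show ?thesis by simp
qed

section \<open>Integration with respect to a positive set function\<close>

text \<open>Gives access to Bochner integration. As \<open>ennreal\<close> clips negative values to
  0, the set function is represented faithfully only when it is positive.\<close>

definition to_measure :: "'a measure \<Rightarrow> ('a set \<Rightarrow> real) \<Rightarrow> 'a measure" where
  "to_measure M \<alpha> = measure_of (space M) (sets M) (\<lambda>A. ennreal (\<alpha> A))"

lemma sets_to_measure [simp, measurable_cong]: "sets (to_measure M \<alpha>) = sets M"
  and space_to_measure [simp]: "space (to_measure M \<alpha>) = space M"
  by (simp_all add: to_measure_def)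

lemma emeasure_to_measure:
  assumes "\<alpha> \<in> pos_measures M" "A \<in> sets M"
  shows "emeasure (to_measure M \<alpha>) A = ennreal (\<alpha> A)"
proof (rule emeasure_measure_of[OF to_measure_def])
  have pos: "\<And>B. B \<in> sets M \<Longrightarrow> 0 \<le> \<alpha> B" and vm: "\<alpha> \<in> vector_measures M"
    using assms by (auto simp: pos_measures_def)
  show "positive (sets (to_measure M \<alpha>)) (\<lambda>A. ennreal (\<alpha> A))"
    using vector_measures_empty[OF vm] by (simp add: positive_def)
  show "countably_additive (sets (to_measure M \<alpha>)) (\<lambda>A. ennreal (\<alpha> A))"
    unfolding countably_additive_def sets_to_measure
  proof (intro allI impI)
    fix A :: "nat \<Rightarrow> 'a set"
    assume A: "range A \<subseteq> sets M" "disjoint_family A"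
    then show "(\<Sum>i. ennreal (\<alpha> (A i))) = ennreal (\<alpha> (\<Union>i. A i))"
      using vector_measures_sums[OF vm A] pos
      by (subst suminf_ennreal2) (auto simp: sums_iff)
  qed
qed (use assms sets.space_closed in auto)

lemma measure_to_measure:
  assumes "\<alpha> \<in> pos_measures M" "A \<in> sets M"
  shows "measure (to_measure M \<alpha>) A = \<alpha> A"
  using emeasure_to_measure[OF assms] assms by (simp add: measure_def pos_measures_def)

lemma finite_measure_to_measure:
  assumes "\<alpha> \<in> pos_measures M"
  shows "finite_measure (to_measure M \<alpha>)"
  by (rule finite_measureI) (simp add: emeasure_to_measure[OF assms])

section \<open>Dependence of the integral on the measure\<close>

lemma integrable_mono_measure:
  fixes f :: "'a \<Rightarrow> 'b::{banach, second_countable_topology}"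
  assumes "sets A = sets N" "\<And>X. X \<in> sets N \<Longrightarrow> emeasure A X \<le> emeasure N X" "integrable N f"
  shows "integrable A f"
proof (rule integrableI_bounded)
  show "f \<in> borel_measurable A"
    using borel_measurable_integrable[OF assms(3)] by (simp add: measurable_cong_sets[OF assms(1) refl])
  have "A \<le> N"
    using assms(1,2) by (simp add: le_measure)
  then have "(\<integral>\<^sup>+x. norm (f x) \<partial>A) \<le> (\<integral>\<^sup>+x. norm (f x) \<partial>N)"
    by (rule nn_integral_mono_measure[OF assms(1)])
  also have "\<dots> < \<infinity>"
    using assms(3) by (simp add: integrable_iff_bounded)
  finally show "(\<integral>\<^sup>+x. norm (f x) \<partial>A) < \<infinity>" .
qed

text \<open>Induction over integrable functions: indicators, sums, dominated limits. Integrability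
  with respect to the two summands is inherited because each lies below \<open>N\<close>.\<close>

lemma integral_add_measure:
  fixes f :: "'a \<Rightarrow> 'b::{banach, second_countable_topology}"
  assumes sets: "sets A = sets N" "sets B = sets N"
    and add: "\<And>X. X \<in> sets N \<Longrightarrow> emeasure N X = emeasure A X + emeasure B X"
    and "integrable N f"
  shows "integral\<^sup>L N f = integral\<^sup>L A f + integral\<^sup>L B f"
proof -
  have intA: "integrable A g" if "integrable N g" for g :: "'a \<Rightarrow> 'b"
    using that sets add by (intro integrable_mono_measure[of A N]) auto
  have intB: "integrable B g" if "integrable N g" for g :: "'a \<Rightarrow> 'b"
    using that sets add by (intro integrable_mono_measure[of B N]) auto
  have sp: "space A = space N" "space B = space N"
    using sets by (auto dest: sets_eq_imp_space_eq)
  from assms(4) show ?thesis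
  proof induct
    case (base X c)
    then have "emeasure A X < \<infinity>" "emeasure B X < \<infinity>"
      using add by (auto simp: less_top)
    then have "measure N X = measure A X + measure B X"
      using base add by (simp add: measure_def enn2real_plus)
    then show ?case
      using base \<open>emeasure A X < \<infinity>\<close> \<open>emeasure B X < \<infinity>\<close> sets
      by (simp add: scaleR_add_left)
  next
    case (add f g)
    then show ?case
      using intA intB by simp
  next
    case (lim f s)
    \<comment> \<open>The induction principle supplies the bound and the convergence at every point
      of the space, not merely almost everywhere in \<open>N\<close>. They therefore hold for all
      three measures, and \<open>2 * norm (f x)\<close> is a common dominating function.\<close>
    have bd: "AE x in C. norm (s i x) \<le> 2 * norm (f x)"
      "AE x in C. (\<lambda>i. s i x) \<longlonglongrightarrow> f x" if "space C = space N" for C i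
      using lim that by (auto intro!: AE_I2)
    have "(\<lambda>i. integral\<^sup>L C (s i)) \<longlonglongrightarrow> integral\<^sup>L C f"
      if C: "space C = space N" "integrable C f" "\<And>i. integrable C (s i)" for C
      using C bd[OF C(1)]
      by (intro integral_dominated_convergence[of f C s "\<lambda>x. 2 * norm (f x)"]) auto
    from this[of N] this[of A] this[of B]
    have "(\<lambda>i. integral\<^sup>L N (s i)) \<longlonglongrightarrow> integral\<^sup>L N f"
      "(\<lambda>i. integral\<^sup>L A (s i) + integral\<^sup>L B (s i)) \<longlonglongrightarrow> integral\<^sup>L A f + integral\<^sup>L B f"
      using lim intA intB sp by (auto intro!: tendsto_add)
    then show ?case
      using lim LIMSEQ_unique by simp
  qed
qed

text \<open>The measure \<open>h\<close> \<alpha>. The value 0 off the \<sigma>-algebra is what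
  \<open>vector_measures\<close> demands.\<close>

definition weighted :: "'a measure \<Rightarrow> ('a \<Rightarrow> 'b) \<Rightarrow> ('a set \<Rightarrow> real) \<Rightarrow> 'a set \<Rightarrow> 'b::euclidean_space" where
  "weighted M h \<alpha> A = (if A \<in> sets M then LINT x:A|to_measure M \<alpha>. h x else 0)"

context
  fixes M :: "'a measure" and h :: "'a \<Rightarrow> 'b::euclidean_space"
  assumes h_measurable: "h \<in> borel_measurable M" and h_bound: "\<And>x. norm (h x) \<le> 1"
begin

lemma weighted_integrable:
  assumes "\<alpha> \<in> pos_measures M"
  shows "integrable (to_measure M \<alpha>) h"
proof -
  interpret finite_measure "to_measure M \<alpha>"
    by (rule finite_measure_to_measure[OF assms])
  show ?thesis
    using h_measurable h_bound by (intro integrable_const_bound[of h 1]) auto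
qed

lemma weighted_set_integrable:
  assumes "\<alpha> \<in> pos_measures M" "A \<in> sets M"
  shows "set_integrable (to_measure M \<alpha>) A h"
  unfolding set_integrable_def
  using assms weighted_integrable by (intro integrable_mult_indicator) auto

text \<open>The constant 1 in \<open>h_bound\<close> matters here: it is what places the weighted
  measure in K(\<alpha>) itself rather than in K of a multiple of \<alpha>.\<close>

lemma norm_weighted_le:
  assumes al: "\<alpha> \<in> pos_measures M" and A: "A \<in> sets M"
  shows "norm (weighted M h \<alpha> A) \<le> \<alpha> A"
proof -
  interpret finite_measure "to_measure M \<alpha>"
    by (rule finite_measure_to_measure[OF al])
  have int: "integrable (to_measure M \<alpha>) (\<lambda>x. indicat_real A x *\<^sub>R h x)"
    using weighted_set_integrable[OF assms] by (simp add: set_integrable_def)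
  have "norm (LINT x:A|to_measure M \<alpha>. h x) \<le> (\<integral>x. norm (indicat_real A x *\<^sub>R h x) \<partial>to_measure M \<alpha>)"
    unfolding set_lebesgue_integral_def by (rule integral_norm_bound)
  also have "\<dots> \<le> (\<integral>x. indicator A x \<partial>to_measure M \<alpha>)"
  proof (intro integral_mono integrable_norm int)
    show "integrable (to_measure M \<alpha>) (indicat_real A)"
      using A by (simp add: less_top[symmetric])
  qed (use h_bound in \<open>auto simp: indicator_def\<close>)
  finally have "norm (LINT x:A|to_measure M \<alpha>. h x) \<le> (\<integral>x. indicator A x \<partial>to_measure M \<alpha>)" .
  then show ?thesis
    using A measure_to_measure[OF assms] sets.sets_into_space[OF A]
    by (simp add: weighted_def Int_absorb2)
qed

lemma weighted_vector_measures:
  assumes al: "\<alpha> \<in> pos_measures M"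
  shows "weighted M h \<alpha> \<in> vector_measures M"
proof -
  have "(\<lambda>i. weighted M h \<alpha> (A i)) sums weighted M h \<alpha> (\<Union>i::nat. A i)"
    if A: "range A \<subseteq> sets M" "disjoint_family A" for A
  proof -
    have "weighted M h \<alpha> (\<Union>i. A i) = (\<Sum>i. weighted M h \<alpha> (A i))"
      using A unfolding weighted_def
      by (subst lebesgue_integral_countable_add)
        (auto simp: disjoint_family_on_def intro!: weighted_set_integrable[OF al])
    \<comment> \<open>The preceding identity between \<open>suminf\<close> values does not assert
      convergence. That follows by comparison with the convergent series of the
      \<alpha>-masses.\<close>
    moreover have "summable (\<lambda>i. weighted M h \<alpha> (A i))"
    proof (rule summable_comparison_test')
      show "summable (\<lambda>i. \<alpha> (A i))"
        using al A vector_measures_sums unfolding pos_measures_def by (blast intro: sums_summable)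
      show "norm (weighted M h \<alpha> (A i)) \<le> \<alpha> (A i)" if "0 \<le> i" for i
        using A by (intro norm_weighted_le[OF al]) auto
    qed
    ultimately show ?thesis by (simp add: summable_sums)
  qed
  then show ?thesis
    unfolding vector_measures_def by (auto simp: weighted_def)
qed

lemma weighted_K_set:
  assumes "\<alpha> \<in> pos_measures M"
  shows "weighted M h \<alpha> \<in> K_set M \<alpha>"
  using assms by (simp add: K_set_iff weighted_vector_measures norm_weighted_le)

lemma weighted_add:
  assumes "\<alpha> \<in> pos_measures M" "\<beta> \<in> pos_measures M"
  shows "weighted M h (\<alpha> + \<beta>) = weighted M h \<alpha> + weighted M h \<beta>"
proof
  fix A
  show "weighted M h (\<alpha> + \<beta>) A = (weighted M h \<alpha> + weighted M h \<beta>) A"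
  proof (cases "A \<in> sets M")
    case True
    have ab: "\<alpha> + \<beta> \<in> pos_measures M"
      using assms by (rule pos_measures_add)
    have "emeasure (to_measure M (\<alpha> + \<beta>)) X = emeasure (to_measure M \<alpha>) X + emeasure (to_measure M \<beta>) X"
      if "X \<in> sets M" for X
      using that assms by (simp add: emeasure_to_measure ab) (simp add: pos_measures_def ennreal_plus)
    then show ?thesis
      using True weighted_set_integrable[OF ab True]
      unfolding weighted_def set_lebesgue_integral_def set_integrable_def
      by (simp only: if_True plus_fun_apply, intro integral_add_measure) auto
  qed (simp add: weighted_def)
qed

text \<open>With T = |\<alpha> - \<beta>| and P = T + (\<alpha> - \<beta>), the difference equals hP
  - hT, and P \<le> 2T, so its norm is at most P + T \<le> 3T on every set. The factor 3 is not
  sharp, but any fixed factor yields convergence.\<close>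

lemma tv_norm_weighted_diff:
  assumes a: "\<alpha> \<in> pos_measures M" and b: "\<beta> \<in> pos_measures M"
  shows "tv_norm M (weighted M h \<alpha> - weighted M h \<beta>) \<le> 3 * tv_norm M (\<alpha> - \<beta>)"
proof -
  define T where "T = total_variation M (\<alpha> - \<beta>)"
  have ab: "\<alpha> - \<beta> \<in> vector_measures M"
    using a b by (intro vector_measures_diff) (auto simp: pos_measures_def)
  have T: "T \<in> pos_measures M"
    unfolding T_def using ab by (rule total_variation_pos_measures)
  have nT: "\<bar>\<alpha> A - \<beta> A\<bar> \<le> T A" if "A \<in> sets M" for A
    using norm_le_total_variation[OF ab that] by (simp add: T_def)
  \<comment> \<open>This is twice the positive part of the signed measure \<alpha> -
    \<beta>.\<close>
  define P where "P = T + (\<alpha> - \<beta>)"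
  have P: "P \<in> pos_measures M"
    using T ab nT unfolding P_def pos_measures_def
    by (auto intro!: vector_measures_add simp: abs_le_iff) (smt (verit))
  \<comment> \<open>Integration was only set up for positive set functions, hence the sums in place of \<open>\<alpha> - \<beta>\<close>.\<close>
  have "\<alpha> + T = \<beta> + P" by (simp add: P_def)
  then have "weighted M h \<alpha> + weighted M h T = weighted M h \<beta> + weighted M h P"
    using weighted_add a b T P by metis
  then have eq: "weighted M h \<alpha> - weighted M h \<beta> = weighted M h P - weighted M h T"
    by (simp add: algebra_simps)
  have le: "norm ((weighted M h \<alpha> - weighted M h \<beta>) A) \<le> (T + T + T) A" if A: "A \<in> sets M" for A
  proof -
    have "norm ((weighted M h \<alpha> - weighted M h \<beta>) A) \<le> norm (weighted M h P A) + norm (weighted M h T A)"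
      unfolding eq by (simp add: norm_triangle_ineq4)
    also have "\<dots> \<le> P A + T A"
      using norm_weighted_le[OF P A] norm_weighted_le[OF T A] by simp
    also have "\<dots> \<le> (T + T + T) A"
      using nT[OF A] by (simp add: P_def)
    finally show ?thesis .
  qed
  have "T + T + T \<in> pos_measures M"
    using T by (intro pos_measures_add)
  from total_variation_le[OF this, of "weighted M h \<alpha> - weighted M h \<beta>", OF le sets.top] show ?thesis
    by (simp add: tv_norm_def T_def)
qed

end

section \<open>Bounded densities\<close>

text \<open>Adding \<alpha> turns \<sigma> into a positive measure, to which Radon-Nikodym applies;
  subtracting 1 from the resulting density undoes the shift.\<close>

lemma signed_density_exists:
  fixes \<sigma> :: "'a set \<Rightarrow> real"
  assumes al: "\<alpha> \<in> pos_measures M" and si: "\<sigma> \<in> vector_measures M"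
    and le: "\<And>A. A \<in> sets M \<Longrightarrow> \<bar>\<sigma> A\<bar> \<le> \<alpha> A"
  shows "\<exists>f. integrable (to_measure M \<alpha>) f \<and> (\<forall>A\<in>sets M. \<sigma> A = (LINT x:A|to_measure M \<alpha>. f x))"
proof -
  define \<beta> where "\<beta> = \<sigma> + \<alpha>"
  have be: "\<beta> \<in> pos_measures M"
    using al si le unfolding \<beta>_def pos_measures_def
    by (auto intro!: vector_measures_add simp: abs_le_iff) (smt (verit))
  let ?A = "to_measure M \<alpha>" and ?B = "to_measure M \<beta>"
  interpret A: finite_measure ?A by (rule finite_measure_to_measure[OF al])
  interpret B: finite_measure ?B by (rule finite_measure_to_measure[OF be])
  have ac: "absolutely_continuous ?A ?B"
    unfolding absolutely_continuous_def
  proof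
    fix X assume "X \<in> null_sets ?A"
    then have X: "X \<in> sets M" "\<alpha> X \<le> 0"
      using emeasure_to_measure[OF al, of X] by (auto simp: null_sets_def ennreal_eq_0_iff)
    \<comment> \<open>Domination of \<sigma> gives \<beta> \<le> 2\<alpha> on measurable sets, hence
      absolute continuity.\<close>
    then have "\<beta> X \<le> 0"
      using le[of X] by (simp add: \<beta>_def)
    then show "X \<in> null_sets ?B"
      using X emeasure_to_measure[OF be, of X] by (auto simp: null_sets_def ennreal_eq_0_iff)
  qed
  \<comment> \<open>\<open>RN_deriv\<close> is extended-real valued. Finiteness of \<open>?B\<close>
    makes it finite almost everywhere, so a real-valued version exists.\<close>
  obtain D where D: "D \<in> borel_measurable ?A" "AE x in ?A. RN_deriv ?A ?B x = ennreal (D x)"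
    "\<And>x. 0 \<le> D x"
    using A.real_RN_deriv[OF B.finite_measure_axioms ac] by auto
  have dens: "density ?A D = ?B"
    using A.density_RN_deriv[OF ac] D
    by (subst density_cong[of _ _ "RN_deriv ?A ?B"]) auto
  \<comment> \<open>The integral of \<open>D\<close> is the total mass of \<open>?B\<close>, so
    integrability amounts to integrating the constant 1 over a finite measure.\<close>
  have intD: "integrable ?A D"
  proof -
    have "integrable (density ?A D) (\<lambda>x. 1::real)"
      unfolding dens by simp
    then show ?thesis
      using D by (subst (asm) integrable_density) auto
  qed
  have "\<sigma> X = (LINT x:X|?A. D x - 1)" if X: "X \<in> sets M" for X
  proof -
    have "\<beta> X = (\<integral>x. indicator X x \<partial>?B)"
      using X measure_to_measure[OF be X] sets.sets_into_space[OF X] by (simp add: Int_absorb2)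
    also have "\<dots> = (LINT x:X|?A. D x)"
      unfolding dens[symmetric] set_lebesgue_integral_def
      using D X by (subst integral_density) (auto simp: mult.commute)
    finally have "\<beta> X = (LINT x:X|?A. D x)" .
    moreover have "\<alpha> X = (LINT x:X|?A. 1)"
      using X measure_to_measure[OF al X] sets.sets_into_space[OF X]
      by (simp add: set_lebesgue_integral_def Int_absorb2)
    moreover have "set_integrable ?A X D" "set_integrable ?A X (\<lambda>x. 1::real)"
      using X intD unfolding set_integrable_def by (auto intro!: integrable_mult_indicator simp del: real_scaleR_def)
    ultimately show ?thesis
      by (simp add: set_integral_diff \<beta>_def)
  qed
  then show ?thesis
    using intD by (intro exI[of _ "\<lambda>x. D x - 1"]) auto
qed

text \<open>The norm is controlled through all linear functionals:
  \<open>h x \<bullet> q \<le> norm q\<close> is shown almost everywhere for each fixed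
  \<open>q\<close>, then for all \<open>q\<close> simultaneously, and finally used with
  \<open>q = h x\<close>.\<close>

lemma AE_norm_le_1:
  fixes h :: "'a \<Rightarrow> 'b::euclidean_space"
  assumes "finite_measure N" and h: "integrable N h"
    and le: "\<And>A. A \<in> sets N \<Longrightarrow> norm (LINT x:A|N. h x) \<le> measure N A"
  shows "AE x in N. norm (h x) \<le> 1"
proof -
  interpret finite_measure N by fact
  have hm[measurable]: "h \<in> borel_measurable N" using h by auto
  have ae: "AE x in N. h x \<bullet> q \<le> norm q" for q
  proof -
    \<comment> \<open>On this exceptional set the integrand \<open>?g\<close> is positive, while
      Cauchy-Schwarz and the assumed bound on the integral over \<open>A\<close> make its integral
      at most 0. Hence \<open>?g\<close> vanishes almost everywhere and \<open>A\<close> is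
      null.\<close>
    define A where "A = {x \<in> space N. h x \<bullet> q > norm q}"
    have A[measurable]: "A \<in> sets N" unfolding A_def by measurable
    let ?g = "\<lambda>x. indicat_real A x * (h x \<bullet> q - norm q)"
    have int: "integrable N (\<lambda>x. indicat_real A x *\<^sub>R h x)"
      using h by (intro integrable_mult_indicator) auto
    have "integrable N (\<lambda>x. h x \<bullet> q - norm q)" using h by auto
    then have ig: "integrable N ?g"
      using integrable_mult_indicator[OF A, of "\<lambda>x. h x \<bullet> q - norm q"] by simp
    have nn: "AE x in N. 0 \<le> ?g x" by (auto simp: A_def indicator_def)
    have "integral\<^sup>L N ?g = (\<integral>x. (indicat_real A x *\<^sub>R h x) \<bullet> q - indicat_real A x * norm q \<partial>N)"
      by (intro Bochner_Integration.integral_cong) (auto simp: algebra_simps)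
    also have "\<dots> = (LINT x:A|N. h x) \<bullet> q - measure N A * norm q"
      using int A sets.sets_into_space[OF A] unfolding set_lebesgue_integral_def
      by (subst Bochner_Integration.integral_diff) (auto simp: Int_absorb2 less_top[symmetric] simp del: inner_scaleR_left)
    also have "\<dots> \<le> 0"
    proof -
      have "(LINT x:A|N. h x) \<bullet> q \<le> norm (LINT x:A|N. h x) * norm q"
        by (rule norm_cauchy_schwarz)
      also have "\<dots> \<le> measure N A * norm q"
        using le[OF A] by (intro mult_right_mono) auto
      finally show ?thesis by simp
    qed
    finally have "integral\<^sup>L N ?g = 0"
      using integral_nonneg_AE[OF nn] by simp
    then have "AE x in N. ?g x = 0"
      using integral_nonneg_eq_0_iff_AE[OF ig nn] by simp
    then show ?thesis
      by (rule AE_mp) (auto simp: A_def indicator_def intro!: AE_I2)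
  qed
  \<comment> \<open>The exceptional null set depends on \<open>q\<close>, so only countably many
    directions can be combined. For fixed \<open>x\<close> the violating directions form an open
    set, which would meet the dense set \<open>Q\<close> if it were nonempty.\<close>
  obtain Q :: "'b set" where Q: "countable Q" "\<And>X. open X \<Longrightarrow> X \<noteq> {} \<Longrightarrow> \<exists>d\<in>Q. d \<in> X"
    using countable_dense_setE by blast
  have "AE x in N. \<forall>q\<in>Q. h x \<bullet> q \<le> norm q"
    using Q(1) ae by (simp add: AE_ball_countable)
  then show ?thesis
  proof (rule AE_mp, intro AE_I2 impI)
    fix x assume x: "\<forall>q\<in>Q. h x \<bullet> q \<le> norm q"
    have "open {q. norm q < h x \<bullet> q}"
      by (intro open_Collect_less continuous_intros)
    then have "{q. norm q < h x \<bullet> q} = {}"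
      using Q(2) x by (metis (mono_tags, lifting) mem_Collect_eq not_le)
    then have "h x \<bullet> h x \<le> norm (h x)"
      by (metis (mono_tags, lifting) empty_Collect_eq not_le)
    then show "norm (h x) \<le> 1"
      by (cases "h x = 0") (auto simp: dot_square_norm power2_eq_square)
  qed
qed

text \<open>Radon-Nikodym is applied to each coordinate of \<mu> and the densities are reassembled.
  Bounds on the coordinates alone would not give Euclidean norm at most 1; that comes from
  \<open>AE_norm_le_1\<close> applied to the whole vector.\<close>

lemma K_set_density_exists:
  fixes \<mu> :: "'a set \<Rightarrow> 'b::euclidean_space"
  assumes "\<mu> \<in> K_set M \<alpha>"
  shows "\<exists>h. h \<in> borel_measurable M \<and> (\<forall>x. norm (h x) \<le> 1) \<and> \<mu> = weighted M h \<alpha>"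
proof -
  have al: "\<alpha> \<in> pos_measures M" using assms by (rule K_set_nonempty_imp_pos)
  have mu: "\<mu> \<in> vector_measures M" and le: "\<And>A. A \<in> sets M \<Longrightarrow> norm (\<mu> A) \<le> \<alpha> A"
    using assms K_set_iff[OF al] by auto
  let ?A = "to_measure M \<alpha>"
  have "\<exists>f. integrable ?A f \<and> (\<forall>A\<in>sets M. \<mu> A \<bullet> b = (LINT x:A|?A. f x))" if b: "b \<in> Basis" for b
    using vector_measures_inner[OF mu] Basis_le_norm[OF b] le
    by (intro signed_density_exists[OF al]) (blast intro: order_trans)+
  then obtain f where f: "\<And>b. b \<in> Basis \<Longrightarrow> integrable ?A (f b)"
    "\<And>b A. b \<in> Basis \<Longrightarrow> A \<in> sets M \<Longrightarrow> \<mu> A \<bullet> b = (LINT x:A|?A. f b x)"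
    by metis
  define h where "h x = (\<Sum>b\<in>Basis. f b x *\<^sub>R b)" for x
  have h: "integrable ?A h"
    unfolding h_def using f(1) by (intro Bochner_Integration.integrable_sum) auto
  have mu_h: "\<mu> A = (LINT x:A|?A. h x)" if A: "A \<in> sets M" for A
  proof (rule euclidean_eqI)
    fix b :: 'b assume b: "b \<in> Basis"
    have "integrable ?A (\<lambda>x. indicat_real A x *\<^sub>R h x)"
      using A h by (intro integrable_mult_indicator) auto
    then have "(LINT x:A|?A. h x) \<bullet> b = (\<integral>x. (indicat_real A x *\<^sub>R h x) \<bullet> b \<partial>?A)"
      unfolding set_lebesgue_integral_def by (intro integral_inner_left[symmetric]) auto
    also have "\<dots> = (LINT x:A|?A. f b x)"
      using b by (simp add: set_lebesgue_integral_def h_def)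
    finally show "\<mu> A \<bullet> b = (LINT x:A|?A. h x) \<bullet> b"
      using f(2)[OF b A] by simp
  qed
  have ae: "AE x in ?A. norm (h x) \<le> 1"
    using mu_h le measure_to_measure[OF al] finite_measure_to_measure[OF al]
    by (intro AE_norm_le_1[OF _ h]) auto
  have hm: "h \<in> borel_measurable M"
    using h by (auto cong: measurable_cong_sets)
  \<comment> \<open>The bound must hold everywhere, not just \<alpha>-almost everywhere: the same
    density is later integrated against other measures, for which an \<alpha>-null set may have
    positive mass.\<close>
  define k where "k x = (if norm (h x) \<le> 1 then h x else 0)" for x
  have km: "k \<in> borel_measurable M" unfolding k_def using hm by measurable
  have "\<mu> = weighted M k \<alpha>"
  proof
    fix A
    show "\<mu> A = weighted M k \<alpha> A"
    proof (cases "A \<in> sets M")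
      case True
      then have "(LINT x:A|?A. h x) = (LINT x:A|?A. k x)"
        using ae hm km by (intro set_lebesgue_integral_cong_AE) (auto simp: k_def)
      then show ?thesis using True mu_h by (simp add: weighted_def)
    next
      case False
      then show ?thesis using mu by (simp add: weighted_def vector_measures_def)
    qed
  qed
  then show ?thesis
    using km by (intro exI[of _ k]) (auto simp: k_def)
qed

section \<open>The approximating sequence\<close>

theorem theorem4p10:
  fixes \<Omega> :: "(real ^ 'm) set"
    and \<alpha>s :: "nat \<Rightarrow> (real ^ 'm) set \<Rightarrow> real"
    and \<alpha> :: "(real ^ 'm) set \<Rightarrow> real"
    and \<mu> :: "(real ^ 'm) set \<Rightarrow> real ^ 'n"
  assumes "open \<Omega>"
    and "\<And>n. \<alpha>s n \<in> pos_measures (borel_on \<Omega>)"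
    and "\<alpha> \<in> vector_measures (borel_on \<Omega>)"
    and "tv_tendsto (borel_on \<Omega>) \<alpha>s \<alpha>"
    and "\<mu> \<in> K_set (borel_on \<Omega>) \<alpha>"
  shows "\<exists>\<mu>s :: nat \<Rightarrow> (real ^ 'm) set \<Rightarrow> real ^ 'n.
           (\<forall>n. \<mu>s n \<in> K_set (borel_on \<Omega>) (\<alpha>s n)) \<and> tv_tendsto (borel_on \<Omega>) \<mu>s \<mu>"
proof -
  let ?M = "borel_on \<Omega>"
  obtain h where h: "h \<in> borel_measurable ?M" "\<And>x. norm (h x) \<le> 1" and mu: "\<mu> = weighted ?M h \<alpha>"
    using K_set_density_exists[OF assms(5)] by blast
  have al: "\<alpha> \<in> pos_measures ?M"
    using assms(5) by (rule K_set_nonempty_imp_pos)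
  have "(\<lambda>n. 3 * tv_norm ?M (\<alpha>s n - \<alpha>)) \<longlonglongrightarrow> 0"
    using assms(4) unfolding tv_tendsto_def by (rule tendsto_mult_right_zero)
  then have "tv_tendsto ?M (\<lambda>n. weighted ?M h (\<alpha>s n)) \<mu>"
    unfolding tv_tendsto_def mu
  proof (rule Lim_null_comparison[rotated], intro always_eventually allI)
    \<comment> \<open>The outer norm is harmless, since \<open>tv_norm\<close> is a value of
      \<open>enn2real\<close> and so nonnegative.\<close>
    show "norm (tv_norm ?M (weighted ?M h (\<alpha>s n) - weighted ?M h \<alpha>)) \<le> 3 * tv_norm ?M (\<alpha>s n - \<alpha>)" for n
      using tv_norm_weighted_diff[OF h assms(2) al, of n]
      by (simp add: tv_norm_def total_variation_def)
  qed
  then show ?thesis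
    using weighted_K_set[OF h assms(2)] by (intro exI[of _ "\<lambda>n. weighted ?M h (\<alpha>s n)"]) simp
qed

end
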